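(* Let $a\in(0,1]$ and $z_k=k+a-1$ for $k\ge1$. Define $\frac{1}{\tilde z_k}=\sum_{i=1}^{k-1}\frac{1}{z_i-z_k}+\sum_{i=k+1}^{\infty}\left(\frac{1}{z_i-z_k}-\frac{1}{z_i}\right)$ and $\tilde\zeta_{\mathcal Z}(s)=\sum_{n\ge1}\frac{1}{\tilde z_nz_n^{s-1}}$. Then $$\frac{1}{\tilde z_k}=\psi(k+a)-\psi(k)\quad(k\ge1),$$ and, for complex $s$ with $\operatorname{Re}(s)>2$, $$\tilde\zeta_{\mathcal Z}(s)=\zeta_H(s-1,a)\big[\psi(a+1)-\psi(1)\big]-a\sum_{l=0}^{\infty}\frac{\zeta_H(s-1,a+l+1)}{(a+l+1)(l+1)}.$$
   Context: $\psi=\Gamma'/\Gamma$ is the digamma function and $\zeta_H(s,z)=\sum_{n\ge0}(z+n)^{-s}$ is the Hurwitz zeta function. *)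

theory Defs
  imports "HOL-Analysis.Analysis"
begin

definition hurwitz_zeta :: "complex \<Rightarrow> complex \<Rightarrow> complex" where
  "hurwitz_zeta s z = (\<Sum>n. (z + of_nat n) powr (- s))"

text \<open>Sequences \<open>z\<^sub>1, z\<^sub>2, \<dots>\<close> are functions on \<open>nat\<close> whose value at 0 is never used.\<close>

definition zseq :: "real \<Rightarrow> nat \<Rightarrow> real" where
  "zseq a k = real k + a - 1"

text \<open>The summand of the tail \<open>i > k\<close>, with \<open>i = k + 1 + j\<close>.\<close>

definition recip_tilde_tail :: "(nat \<Rightarrow> real) \<Rightarrow> nat \<Rightarrow> nat \<Rightarrow> real" where
  "recip_tilde_tail z k j = 1 / (z (k + 1 + j) - z k) - 1 / z (k + 1 + j)"

text \<open>The number \<open>recip_tilde z k\<close> is the quantity written \<open>1 / z~\<^sub>k\<close>.\<close>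

definition recip_tilde :: "(nat \<Rightarrow> real) \<Rightarrow> nat \<Rightarrow> real" where
  "recip_tilde z k =
     (\<Sum>i\<in>{1..<k}. 1 / (z i - z k)) + (\<Sum>j. recip_tilde_tail z k j)"

definition tilde_zeta_term :: "(nat \<Rightarrow> real) \<Rightarrow> complex \<Rightarrow> nat \<Rightarrow> complex" where
  "tilde_zeta_term z s n = of_real (recip_tilde z n) / of_real (z n) powr (s - 1)"

definition tilde_zeta :: "(nat \<Rightarrow> real) \<Rightarrow> complex \<Rightarrow> complex" where
  "tilde_zeta z s = (\<Sum>n. tilde_zeta_term z s (Suc n))"

end

theory Submission
  imports Defs
begin

text \<open>
  The recurrence of \<open>\<psi>\<close> gives \<open>1 / z~\<^sub>n\<^sub>+\<^sub>1 = (\<psi>(a + 1) - \<psi>(1)) - a \<Sum>\<^bsub>l<n\<^esub> c\<^sub>l\<close> with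
  \<open>c\<^sub>l = 1 / ((a + l + 1) (l + 1))\<close>. Multiplying by \<open>(a + n)\<^bsup>1 - s\<^esup>\<close> and summing over \<open>n\<close>,
  summation by parts moves the partial sums of \<open>c\<close> onto the tails
  \<open>\<Sum>\<^bsub>n>l\<^esub> (a + n)\<^bsup>1 - s\<^esup>\<close>, which are the Hurwitz zeta values at \<open>a + l + 1\<close>.
\<close>

lemma sum_mult_Suc_by_parts:
  fixes c T :: "nat \<Rightarrow> 'a :: ring"
  shows "(\<Sum>l<N. c l * T (Suc l)) = (\<Sum>n<N. (\<Sum>l<n. c l) * (T n - T (Suc n))) + (\<Sum>l<N. c l) * T N"
  by (induction N) (simp_all add: algebra_simps)

lemma
  fixes c w :: "nat \<Rightarrow> 'a :: {real_normed_algebra, banach}"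
  assumes bounded: "Bseq (\<lambda>n. \<Sum>l<n. c l)" and abs_summable: "summable (\<lambda>n. norm (w n))"
  shows summable_partial_sum_mult: "summable (\<lambda>n. (\<Sum>l<n. c l) * w n)"
    and sums_mult_tail: "(\<lambda>l. c l * (\<Sum>m. w (m + Suc l))) sums (\<Sum>n. (\<Sum>l<n. c l) * w n)"
proof -
  define C where "C n = (\<Sum>l<n. c l)" for n
  define T where "T n = (\<Sum>m. w (m + n))" for n
  obtain B where norm_C_le: "norm (C n) \<le> B" for n
    using bounded unfolding Bseq_def C_def by blast
  show summable_Cw: "summable (\<lambda>n. (\<Sum>l<n. c l) * w n)"
  proof (rule summable_comparison_test'[OF summable_mult[OF abs_summable]])
    show "norm ((\<Sum>l<n. c l) * w n) \<le> B * norm (w n)" for n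
      using norm_mult_ineq[of "C n" "w n"]
        mult_right_mono[OF norm_C_le[of n] norm_ge_zero[of "w n"]]
      by (simp add: C_def)
  qed
  have summable_w: "summable w"
    using abs_summable by (rule summable_norm_cancel)
  have "T n - T (Suc n) = w n" for n
    by (simp add: T_def suminf_minus_initial_segment[OF summable_w] flip: add_Suc_right)
  then have parts: "(\<Sum>l<N. c l * T (Suc l)) = (\<Sum>n<N. C n * w n) + C N * T N" for N
    using sum_mult_Suc_by_parts[of c T N] by (simp add: C_def)
  have "T \<longlonglongrightarrow> 0"
    unfolding T_def by (rule suminf_exist_split2[OF summable_w])
  then have "(\<lambda>N. C N * T N) \<longlonglongrightarrow> 0"
    using bounded unfolding C_def tendsto_Zfun_iff diff_zero
    by (intro bounded_bilinear.Bfun_prod_Zfun[OF bounded_bilinear_mult])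
  then have "(\<lambda>N. (\<Sum>n<N. C n * w n) + C N * T N) \<longlonglongrightarrow> (\<Sum>n. C n * w n) + 0"
    using summable_Cw unfolding C_def by (intro tendsto_add summable_LIMSEQ)
  then show "(\<lambda>l. c l * (\<Sum>m. w (m + Suc l))) sums (\<Sum>n. (\<Sum>l<n. c l) * w n)"
    unfolding sums_def T_def[symmetric] C_def[symmetric] parts by simp
qed

lemma norm_powr_complex_le:
  fixes z s :: complex
  shows "norm (z powr s) \<le> norm z powr Re s * exp (pi * \<bar>Im s\<bar>)"
proof -
  have "- Im s * Arg z \<le> \<bar>Im s\<bar> * \<bar>Arg z\<bar>"
    by (metis abs_ge_self abs_minus_cancel abs_mult)
  also have "\<dots> \<le> pi * \<bar>Im s\<bar>"
    using Arg_bounded[of z] by (subst mult.commute, intro mult_right_mono) auto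
  finally show ?thesis
    by (auto simp: norm_powr_complex intro!: mult_left_mono)
qed

lemma summable_norm_shifted_powr:
  fixes z s :: complex
  assumes "Re s > 1"
  shows "summable (\<lambda>n. norm ((z + of_nat n) powr (- s)))"
proof (rule summable_comparison_test'[where N = "Suc (nat \<lceil>2 * norm z\<rceil>)"])
  have "summable (\<lambda>n. real n powr (- Re s))"
    using assms by (simp add: summable_real_powr_iff)
  then have "summable (\<lambda>n. real n powr (- Re s) / 2 powr (- Re s) * exp (pi * \<bar>Im s\<bar>))"
    by (intro summable_mult2 summable_divide)
  then show "summable (\<lambda>n. (real n / 2) powr (- Re s) * exp (pi * \<bar>Im s\<bar>))"
    by (simp add: powr_divide)
next
  fix n :: nat
  assume n: "n \<ge> Suc (nat \<lceil>2 * norm z\<rceil>)"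
  then have "real n / 2 \<le> real n - norm z"
    by linarith
  also have "\<dots> \<le> norm (z + of_nat n)"
    using norm_triangle_ineq2[of "of_nat n" "- z"] by (simp add: add.commute)
  finally have half_le: "real n / 2 \<le> norm (z + of_nat n)" .
  have "norm ((z + of_nat n) powr (- s)) \<le> norm (z + of_nat n) powr (- Re s) * exp (pi * \<bar>Im s\<bar>)"
    using norm_powr_complex_le[of "z + of_nat n" "- s"] by simp
  also have "\<dots> \<le> (real n / 2) powr (- Re s) * exp (pi * \<bar>Im s\<bar>)"
    using assms n half_le by (intro mult_right_mono powr_mono2') auto
  finally show "norm (norm ((z + of_nat n) powr (- s)))
      \<le> (real n / 2) powr (- Re s) * exp (pi * \<bar>Im s\<bar>)"
    by simp
qed

lemma hurwitz_zeta_sums: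
  assumes "Re s > 1"
  shows "(\<lambda>n. (z + of_nat n) powr (- s)) sums hurwitz_zeta s z"
  unfolding hurwitz_zeta_def
  using assms by (intro summable_sums summable_norm_cancel[OF summable_norm_shifted_powr])

lemma hurwitz_zeta_add_of_nat:
  "hurwitz_zeta s (z + of_nat n) = (\<Sum>m. (z + of_nat (m + n)) powr (- s))"
  by (simp add: hurwitz_zeta_def add_ac)

lemma
  fixes c :: "nat \<Rightarrow> complex"
  assumes "Bseq (\<lambda>n. \<Sum>l<n. c l)" and "Re s > 1"
  shows summable_partial_sum_shifted_powr: "summable (\<lambda>n. (\<Sum>l<n. c l) * (z + of_nat n) powr (- s))"
    and sums_mult_hurwitz_zeta: "(\<lambda>l. c l * hurwitz_zeta s (z + of_nat (Suc l)))
      sums (\<Sum>n. (\<Sum>l<n. c l) * (z + of_nat n) powr (- s))"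
  unfolding hurwitz_zeta_add_of_nat
  using summable_partial_sum_mult[OF assms(1) summable_norm_shifted_powr[OF assms(2)]]
    sums_mult_tail[OF assms(1) summable_norm_shifted_powr[OF assms(2)]]
  by blast+

lemma inverse_diff_shift_eq:
  fixes z w :: "'a :: field_char_0"
  assumes "z \<notin> \<int>\<^sub>\<le>\<^sub>0" and "w \<notin> \<int>\<^sub>\<le>\<^sub>0"
  shows "inverse (w + of_nat l) - inverse (z + of_nat l)
           = (z - w) / ((z + of_nat l) * (w + of_nat l))"
proof -
  have "z + of_nat l \<noteq> 0" "w + of_nat l \<noteq> 0"
    using assms plus_of_nat_eq_0_imp by blast+
  then show ?thesis
    by (simp add: field_simps)
qed

lemma sums_Digamma_diff:
  fixes z w :: "'a :: {real_normed_field, banach}"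
  assumes "z \<notin> \<int>\<^sub>\<le>\<^sub>0" and "w \<notin> \<int>\<^sub>\<le>\<^sub>0"
  shows "(\<lambda>l. (z - w) / ((z + of_nat l) * (w + of_nat l))) sums (Digamma z - Digamma w)"
proof -
  have "(\<lambda>l. inverse (of_nat (Suc l)) - inverse (x + of_nat l)) sums (Digamma x + euler_mascheroni)"
    if "x \<notin> \<int>\<^sub>\<le>\<^sub>0" for x :: 'a
    using summable_sums[OF summable_Digamma[of x]] that by (auto simp: Digamma_def)
  from sums_diff[OF this[OF assms(1)] this[OF assms(2)]] show ?thesis
    by (simp flip: inverse_diff_shift_eq[OF assms])
qed

lemma summable_inverse_shift_mult:
  fixes z w :: "'a :: {real_normed_field, banach}"
  assumes "z \<notin> \<int>\<^sub>\<le>\<^sub>0" and "w \<notin> \<int>\<^sub>\<le>\<^sub>0" and "z \<noteq> w"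
  shows "summable (\<lambda>l. 1 / ((z + of_nat l) * (w + of_nat l)))"
  using sums_summable[OF sums_divide[OF sums_Digamma_diff[OF assms(1,2)], of "z - w"]] assms(3)
  by simp

lemma Digamma_diff_plus_of_nat:
  fixes z w :: "'a :: {real_normed_field, banach}"
  assumes "z \<notin> \<int>\<^sub>\<le>\<^sub>0" and "w \<notin> \<int>\<^sub>\<le>\<^sub>0"
  shows "Digamma (z + of_nat n) - Digamma (w + of_nat n)
           = Digamma z - Digamma w - (\<Sum>l<n. (z - w) / ((z + of_nat l) * (w + of_nat l)))"
proof -
  have shift: "Digamma (x + of_nat n) = Digamma x + (\<Sum>l<n. inverse (x + of_nat l))"
    if "x \<notin> \<int>\<^sub>\<le>\<^sub>0" for x :: 'a
    using Polygamma_plus_of_nat[of n x 0] that by (auto simp: inverse_eq_divide)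
  show ?thesis
    using assms by (simp add: shift sum_subtractf flip: inverse_diff_shift_eq)
qed

lemma recip_tilde_tail_zseq_sums:
  assumes "real k + a \<noteq> 0"
  shows "recip_tilde_tail (zseq a) k sums (Digamma (real k + a) + euler_mascheroni)"
proof -
  have "recip_tilde_tail (zseq a) k
      = (\<lambda>j. inverse (of_nat (Suc j)) - inverse (real k + a + of_nat j))"
    by (simp add: fun_eq_iff recip_tilde_tail_def zseq_def field_simps)
  then show ?thesis
    using summable_sums[OF summable_Digamma[OF assms]] by (simp add: Digamma_def)
qed

lemma sum_recip_zseq_diff: "(\<Sum>i\<in>{1..<k}. 1 / (zseq a i - zseq a k)) = - harm (k - 1)"
proof -
  have "(\<Sum>i\<in>{1..<k}. 1 / (zseq a i - zseq a k)) = - (\<Sum>i\<in>{1..<k}. inverse (real (k - i)))"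
    unfolding sum_negf[symmetric]
    by (intro sum.cong) (auto simp: zseq_def divide_simps)
  also have "(\<Sum>i\<in>{1..<k}. inverse (real (k - i))) = harm (k - 1)"
    unfolding harm_def
    by (rule sum.reindex_bij_witness[of _ "\<lambda>i. k - i" "\<lambda>i. k - i"]) auto
  finally show ?thesis .
qed

lemma recip_tilde_zseq:
  assumes "k \<ge> 1" and "real k + a \<noteq> 0"
  shows "recip_tilde (zseq a) k = Digamma (real k + a) - Digamma (real k)"
proof -
  have "Digamma (real k) = harm (k - 1) - euler_mascheroni"
    using Digamma_of_nat[of "k - 1", where 'a = real] assms(1) by simp
  then show ?thesis
    using recip_tilde_tail_zseq_sums[OF assms(2)]
    unfolding recip_tilde_def sum_recip_zseq_diff by (simp add: sums_iff)
qed

lemma recip_tilde_zseq_Suc: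
  assumes "a + 1 \<notin> \<int>\<^sub>\<le>\<^sub>0"
  shows "recip_tilde (zseq a) (Suc n)
           = (Digamma (a + 1) - Digamma 1) - a * (\<Sum>l<n. 1 / ((a + real l + 1) * (real l + 1)))"
proof -
  have "real (Suc n) + a \<noteq> 0"
    using plus_of_nat_eq_0_imp[of "a + 1" n] assms by (auto simp: algebra_simps)
  then show ?thesis
    using recip_tilde_zseq[of "Suc n" a] Digamma_diff_plus_of_nat[OF assms, of 1 n]
    by (simp add: add_ac sum_distrib_left)
qed

lemma tilde_zeta_term_zseq_Suc:
  "tilde_zeta_term (zseq a) s (Suc n)
     = of_real (recip_tilde (zseq a) (Suc n)) * (of_real a + of_nat n) powr (- (s - 1))"
  unfolding tilde_zeta_term_def powr_minus divide_inverse
  by (simp add: zseq_def add.commute)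

lemma
  fixes a :: real and s :: complex
  assumes a_notin: "a \<notin> \<int>\<^sub>\<le>\<^sub>0" and Re_s: "Re s > 2"
  defines "h \<equiv> \<lambda>l. hurwitz_zeta (s - 1) (of_real (a + real l + 1)) /
                      of_real ((a + real l + 1) * (real l + 1))"
  shows summable_hurwitz_zeta_quotient: "summable h"
    and tilde_zeta_zseq_sums: "(\<lambda>n. tilde_zeta_term (zseq a) s (Suc n)) sums
      (hurwitz_zeta (s - 1) (of_real a) * of_real (Digamma (a + 1) - Digamma 1)
        - of_real a * (\<Sum>l. h l))"
proof -
  define c where "c l = 1 / ((a + real l + 1) * (real l + 1))" for l
  define D where "D = Digamma (a + 1) - Digamma 1"
  define w where "w n = (complex_of_real a + of_nat n) powr (- (s - 1))" for n
  have a_plus_1: "a + 1 \<notin> \<int>\<^sub>\<le>\<^sub>0" and Re_s_minus_1: "Re (s - 1) > 1"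
    using a_notin Re_s plus_one_in_nonpos_Ints_imp by auto
  have "summable c"
    using summable_inverse_shift_mult[OF a_plus_1, of 1] a_notin
    by (auto simp: c_def[abs_def] add_ac)
  then have "summable (\<lambda>l. complex_of_real (c l))"
    by (rule summable_of_real)
  then have c_bounded: "Bseq (\<lambda>n. \<Sum>l<n. complex_of_real (c l))"
    unfolding Bseq_eq_bounded by (rule summable_imp_sums_bounded)
  have h_eq: "h = (\<lambda>l. of_real (c l) * hurwitz_zeta (s - 1) (of_real a + of_nat (Suc l)))"
    by (simp add: h_def c_def fun_eq_iff add_ac)
  have h_sums: "h sums (\<Sum>n. (\<Sum>l<n. of_real (c l)) * w n)"
    unfolding h_eq w_def by (rule sums_mult_hurwitz_zeta[OF c_bounded Re_s_minus_1])
  then show "summable h"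
    by (rule sums_summable)
  have "tilde_zeta_term (zseq a) s (Suc n)
      = w n * of_real D - of_real a * ((\<Sum>l<n. of_real (c l)) * w n)" for n
    by (simp add: tilde_zeta_term_zseq_Suc recip_tilde_zseq_Suc[OF a_plus_1] c_def D_def w_def
        algebra_simps)
  moreover have "(\<lambda>n. w n * of_real D - of_real a * ((\<Sum>l<n. of_real (c l)) * w n)) sums
      (hurwitz_zeta (s - 1) (of_real a) * of_real D - of_real a * suminf h)"
    unfolding sums_unique[OF h_sums, symmetric] w_def
    by (intro sums_diff sums_mult sums_mult2 hurwitz_zeta_sums[OF Re_s_minus_1] summable_sums
        summable_partial_sum_shifted_powr[OF c_bounded Re_s_minus_1])
  ultimately show "(\<lambda>n. tilde_zeta_term (zseq a) s (Suc n)) sums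
      (hurwitz_zeta (s - 1) (of_real a) * of_real (Digamma (a + 1) - Digamma 1)
        - of_real a * (\<Sum>l. h l))"
    by (simp add: D_def)
qed

theorem theorem4p1:
  fixes a :: real
  assumes "0 < a" and "a \<le> 1"
  shows "(\<forall>k\<ge>1. summable (recip_tilde_tail (zseq a) k) \<and>
            recip_tilde (zseq a) k = Digamma (real k + a) - Digamma (real k)) \<and>
         (\<forall>s::complex. Re s > 2 \<longrightarrow>
            summable (\<lambda>n. tilde_zeta_term (zseq a) s (Suc n)) \<and>
            summable (\<lambda>l. hurwitz_zeta (s - 1) (of_real (a + real l + 1)) /
                            of_real ((a + real l + 1) * (real l + 1))) \<and>
            tilde_zeta (zseq a) s =
              hurwitz_zeta (s - 1) (of_real a) * of_real (Digamma (a + 1) - Digamma 1)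
              - of_real a * (\<Sum>l. hurwitz_zeta (s - 1) (of_real (a + real l + 1)) /
                                    of_real ((a + real l + 1) * (real l + 1))))"
proof (intro conjI allI impI)
  fix k :: nat
  assume "k \<ge> 1"
  have "real k + a \<noteq> 0"
    using assms(1) by simp
  then show "summable (recip_tilde_tail (zseq a) k)"
    and "recip_tilde (zseq a) k = Digamma (real k + a) - Digamma (real k)"
    using \<open>k \<ge> 1\<close> by (blast intro: sums_summable recip_tilde_tail_zseq_sums recip_tilde_zseq)+
next
  have a_notin: "a \<notin> \<int>\<^sub>\<le>\<^sub>0"
    using assms(1) by auto
  fix s :: complex
  assume Re_s: "Re s > 2"
  show "summable (\<lambda>n. tilde_zeta_term (zseq a) s (Suc n))"
    using tilde_zeta_zseq_sums[OF a_notin Re_s] by (rule sums_summable)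
  show "summable (\<lambda>l. hurwitz_zeta (s - 1) (of_real (a + real l + 1)) /
                         of_real ((a + real l + 1) * (real l + 1)))"
    by (rule summable_hurwitz_zeta_quotient[OF a_notin Re_s])
  show "tilde_zeta (zseq a) s =
          hurwitz_zeta (s - 1) (of_real a) * of_real (Digamma (a + 1) - Digamma 1)
          - of_real a * (\<Sum>l. hurwitz_zeta (s - 1) (of_real (a + real l + 1)) /
                                of_real ((a + real l + 1) * (real l + 1)))"
    unfolding tilde_zeta_def
    by (rule sums_unique[OF tilde_zeta_zseq_sums[OF a_notin Re_s], symmetric])
qed

end
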